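(* Let $n\ge3$ and $u\ge2$ be integers with $\gcd(u,n)=1$, and let $a$ be a square-free rational integer such that every prime divisor of $n$ divides $a$. Let $F(x)=x^n-a^u\in\mathbb{Z}[x]$. Then $F(x)$ is irreducible over $\mathbb{Q}$. Moreover, letting $K=\mathbb{Q}(\alpha)$ with $\alpha$ a root of $F(x)$ and $\mathbb{Z}_K$ the ring of integers of $K$: (1) $\mathbb{Z}[\alpha]\neq\mathbb{Z}_K$; (2) there exists $\theta\in\mathbb{Z}_K$ with $K=\mathbb{Q}(\theta)$ and $\mathbb{Z}_K=\mathbb{Z}[\theta]$; that is, $K$ is monogenic.
   Context: A number field $K$ is monogenic if there is $\theta\in\mathbb{Z}_K$ such that $\{1,\theta,\dots,\theta^{[K:\mathbb{Q}]-1}\}$ is a $\mathbb{Z}$-basis of $\mathbb{Z}_K$. *)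

theory Defs
  imports "HOL-Computational_Algebra.Computational_Algebra"
begin

definition algebraic_int :: "complex \<Rightarrow> bool" where
  "algebraic_int x \<longleftrightarrow> (\<exists>p :: int poly. lead_coeff p = 1 \<and> poly (map_poly of_int p) x = 0)"

text \<open>The field Q(alpha) generated by an algebraic number alpha, as a subset of C.\<close>
definition Qadj :: "complex \<Rightarrow> complex set" where
  "Qadj \<alpha> = {poly (map_poly of_rat p) \<alpha> | p :: rat poly. True}"

definition Zadj :: "complex \<Rightarrow> complex set" where
  "Zadj \<alpha> = {poly (map_poly of_int p) \<alpha> | p :: int poly. True}"

definition ring_of_integers :: "complex set \<Rightarrow> complex set" where
  "ring_of_integers K = {x \<in> K. algebraic_int x}"

end

theory Submission
  imports Defs "Jordan_Normal_Form.Char_Poly" "HOL-Number_Theory.Cong"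
begin

text \<open>
  Choose \<open>s\<close>, \<open>t\<close> with \<open>u s = n t + 1\<close> and put \<open>\<theta> = \<alpha> ^ s / a ^ t\<close>. Then \<open>\<theta> ^ n = a\<close> and
  \<open>\<alpha> = \<theta> ^ u\<close>, so both generate the same field. The key is an Eisenstein argument at a prime \<open>p\<close>
  dividing \<open>a\<close>: if \<open>R(\<theta>) / p\<close> is an algebraic integer for an integer polynomial \<open>R\<close>, then \<open>p\<close>
  divides every coefficient of \<open>R\<close> of index below \<open>n\<close>. Indeed, if \<open>i\<close> is the least index in question
  and \<open>b\<close> its coefficient, multiplication by \<open>\<theta> ^ (n - 1 - i)\<close> shows that \<open>b \<theta> ^ (n - 1) / p\<close> is
  integral; its \<open>n\<close>-th power \<open>b ^ n a ^ (n - 1) / p ^ n\<close> is rational, hence an integer, and \<open>p\<close>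
  divides \<open>b\<close> because \<open>p\<close> divides \<open>a\<close> exactly once.

  For \<open>R(\<theta>) = 0\<close> this shows that \<open>\<theta>\<close> and \<open>\<theta> ^ u\<close> have degree \<open>n\<close>, and that \<open>\<theta>\<close> is not of the form
  \<open>P(\<theta> ^ u)\<close> with integral \<open>P\<close>, since \<open>X - P(X ^ u)\<close> has linear coefficient \<open>1\<close>. Taking traces,
  every integer of the field has coefficients in \<open>\<int> / (n a)\<close> with respect to the powers of \<open>\<theta>\<close>;
  since all primes dividing \<open>n a\<close> divide \<open>a\<close>, the Eisenstein argument removes the denominators.
\<close>

section \<open>The ring of algebraic integers\<close>

lemma algebraic_int_iff: "algebraic_int x \<longleftrightarrow> Polynomial.algebraic_int x"
  unfolding algebraic_int_def Polynomial.algebraic_int_altdef_ipoly by blast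

lemma algebraic_int_of_int_complex [simp]: "algebraic_int (of_int m)"
  by (simp add: algebraic_int_iff)

lemma algebraic_int_rational_is_int:
  "algebraic_int x \<Longrightarrow> x \<in> \<rat> \<Longrightarrow> x \<in> \<int>"
  by (simp add: algebraic_int_iff rational_algebraic_int_is_int)

lemma algebraic_int_nth_root:
  assumes "x ^ n = of_int m" and "n > 0"
  shows "algebraic_int x"
  unfolding algebraic_int_iff
  by (rule Polynomial.algebraic_int_root[where p = "monom 1 n" and y = "of_int m"])
    (use assms in \<open>auto simp: poly_monom degree_monom_eq\<close>)

text \<open>Makes spans available for finitely generated subgroups of the complex numbers.\<close>

interpretation int_module: Modules.module "\<lambda>(c::int) (x::complex). of_int c * x"
  by unfold_locales (auto simp: algebra_simps)

lemma int_span_stable: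
  assumes "\<And>s. s \<in> S \<Longrightarrow> x * s \<in> int_module.span S" and "w \<in> int_module.span S"
  shows "x * w \<in> int_module.span S"
  using assms(2)
proof (induction rule: int_module.span_induct_alt)
  case base
  then show ?case by (simp add: int_module.span_zero)
next
  case (step c s y)
  have "x * (of_int c * s + y) = of_int c * (x * s) + x * y"
    by (simp add: algebra_simps)
  with step assms(1) show ?case
    by (auto intro: int_module.span_add int_module.span_scale)
qed

text \<open>Determinant trick: the vector of the \<open>v i\<close> is an eigenvector of an integer
  matrix with eigenvalue \<open>z\<close>, which is therefore a root of a monic integer polynomial,
  the characteristic polynomial.\<close>

lemma algebraic_int_if_integer_matrix:
  fixes v :: "nat \<Rightarrow> complex" and M :: "nat \<Rightarrow> nat \<Rightarrow> int"
  assumes M: "\<And>i. i < N \<Longrightarrow> z * v i = (\<Sum>j<N. of_int (M i j) * v j)"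
    and k: "k < N" "v k \<noteq> 0"
  shows "algebraic_int z"
proof -
  define A where "A = mat N N (\<lambda>(i, j). M i j)"
  have A: "A \<in> carrier_mat N N" by (simp add: A_def)
  then have A': "map_mat complex_of_int A \<in> carrier_mat N N" by simp
  have "eigenvector (map_mat of_int A) (vec N v) z"
    unfolding eigenvector_def
  proof (intro conjI)
    show "vec N v \<noteq> 0\<^sub>v (dim_row (map_mat complex_of_int A))"
    proof
      assume *: "vec N v = 0\<^sub>v (dim_row (map_mat complex_of_int A))"
      have "vec N v $ k = 0" unfolding * using k by (simp add: A_def)
      with k show False by simp
    qed
    show "map_mat complex_of_int A *\<^sub>v vec N v = z \<cdot>\<^sub>v vec N v"
      using M by (auto simp: A_def scalar_prod_def atLeast0LessThan)
  qed (simp add: A_def)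
  then have "eigenvalue (map_mat of_int A) z"
    unfolding eigenvalue_def by blast
  then have "poly (char_poly (map_mat of_int A)) z = 0"
    using eigenvalue_root_char_poly[OF A'] by simp
  then have "poly (map_poly of_int (char_poly A)) z = 0"
    by (simp add: of_int_hom.char_poly_hom[OF A])
  moreover have "lead_coeff (char_poly A) = 1"
    using degree_monic_char_poly[OF A] by simp
  ultimately show ?thesis
    unfolding algebraic_int_def by blast
qed

text \<open>On a finite generating set, multiplication by \<open>z\<close> is given by integer
  coefficients; \<open>s0\<close> keeps the vector of generators from being zero.\<close>

lemma algebraic_int_if_stabilizes_span:
  assumes "finite S" and s0: "s0 \<in> S" "s0 \<noteq> 0"
    and stable: "\<And>s. s \<in> S \<Longrightarrow> z * s \<in> int_module.span S"
  shows "algebraic_int z"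
proof -
  obtain f where f: "bij_betw f {..<card S} S"
    using ex_bij_betw_nat_finite[OF \<open>finite S\<close>] by (auto simp: atLeast0LessThan)
  have "\<exists>c. z * s = (\<Sum>r\<in>S. of_int (c r) * r)" if "s \<in> S" for s
    using stable[OF that] int_module.span_finite[OF \<open>finite S\<close>] by auto
  then obtain c where c: "\<And>s. s \<in> S \<Longrightarrow> z * s = (\<Sum>r\<in>S. of_int (c s r) * r)"
    by metis
  obtain k where k: "k < card S" "f k = s0"
    using f s0 unfolding bij_betw_def by (metis imageE lessThan_iff)
  show ?thesis
  proof (rule algebraic_int_if_integer_matrix)
    fix i assume "i < card S"
    then have "f i \<in> S" using f by (auto simp: bij_betw_def)
    then show "z * f i = (\<Sum>j<card S. of_int (c (f i) (f j)) * f j)"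
      unfolding c[OF \<open>f i \<in> S\<close>]
      by (rule_tac sum.reindex_bij_betw[OF f, symmetric])
  qed (use k s0 in auto)
qed

lemma monic_root_power_degree:
  assumes "lead_coeff p = 1" "poly (map_poly of_int p) x = 0"
  shows "x ^ degree p = - (\<Sum>l<degree p. of_int (coeff p l) * (x::complex) ^ l)"
proof -
  have "0 = (\<Sum>l\<le>degree p. of_int (coeff p l) * x ^ l)"
    using assms(2) by (simp add: poly_altdef)
  also have "\<dots> = (\<Sum>l<degree p. of_int (coeff p l) * x ^ l) + x ^ degree p"
    using assms(1) by (simp flip: lessThan_Suc_atMost)
  finally show ?thesis
    by (simp add: eq_neg_iff_add_eq_0 add.commute)
qed

text \<open>Raising the exponent of \<open>x\<close> can leave \<open>S\<close> only on reaching
  \<open>degree p\<close>, where the monic relation rewrites the power in lower ones.\<close>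

lemma monomial_span_stable:
  fixes x y :: complex
  assumes p: "lead_coeff p = 1" "poly (map_poly of_int p) x = 0"
    and S: "S = (\<lambda>(i, j). x ^ i * y ^ j) ` ({..<degree p} \<times> {..<k})"
    and s: "s \<in> S"
  shows "x * s \<in> int_module.span S"
proof -
  obtain i j where ij: "i < degree p" "j < k" "s = x ^ i * y ^ j"
    using s S by auto
  have mem: "x ^ l * y ^ j \<in> int_module.span S" if "l < degree p" for l
    using that ij by (auto simp: S intro!: int_module.span_base)
  show ?thesis
  proof (cases "Suc i < degree p")
    case True
    then show ?thesis using mem[of "Suc i"] ij by (simp add: mult.assoc)
  next
    case False
    then have "degree p = Suc i" using ij by simp
    then have "x * s = x ^ degree p * y ^ j"
      using ij by (simp add: mult.assoc)
    also have "\<dots> = - (\<Sum>l<degree p. of_int (coeff p l) * (x ^ l * y ^ j))"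
      unfolding monic_root_power_degree[OF p] by (simp add: sum_distrib_right mult.assoc)
    also have "\<dots> \<in> int_module.span S"
      by (intro int_module.span_neg int_module.span_sum int_module.span_scale mem) auto
    finally show ?thesis .
  qed
qed

text \<open>A single module stable under both \<open>x\<close> and \<open>y\<close> is also stable
  under their sum and product, which yields the closure properties.\<close>

lemma algebraic_int_common_module:
  assumes "algebraic_int x" "algebraic_int y"
  obtains S where "finite S" "1 \<in> S"
    "\<And>s. s \<in> S \<Longrightarrow> x * s \<in> int_module.span S" "\<And>s. s \<in> S \<Longrightarrow> y * s \<in> int_module.span S"
proof -
  obtain p q where p: "lead_coeff p = 1" "poly (map_poly of_int p) x = 0"
    and q: "lead_coeff q = 1" "poly (map_poly of_int q) y = 0"
    using assms unfolding algebraic_int_def by blast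
  \<comment> \<open>A monic constant has no root. Positive degrees put the exponent pair (0, 0),
    that is \<open>1\<close>, into \<open>S\<close>.\<close>
  have pos: "degree r > 0" if "lead_coeff r = 1" "poly (map_poly of_int r) z = 0"
    for r and z :: complex
    using monic_root_power_degree[OF that] by (cases "degree r") auto
  define S where "S = (\<lambda>(i, j). x ^ i * y ^ j) ` ({..<degree p} \<times> {..<degree q})"
  have S': "S = (\<lambda>(i, j). y ^ i * x ^ j) ` ({..<degree q} \<times> {..<degree p})"
    unfolding S_def by (force simp: mult.commute)
  show ?thesis
  proof
    show "finite S" by (simp add: S_def)
    show "1 \<in> S" unfolding S_def
      by (rule image_eqI[of _ _ "(0, 0)"]) (use pos[OF p] pos[OF q] in auto)
  qed (use monomial_span_stable[OF p S_def] monomial_span_stable[OF q S'] in auto)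
qed

lemma algebraic_int_add:
  assumes "algebraic_int x" "algebraic_int y"
  shows "algebraic_int (x + y)"
proof -
  obtain S where S: "finite S" "1 \<in> S"
    "\<And>s. s \<in> S \<Longrightarrow> x * s \<in> int_module.span S" "\<And>s. s \<in> S \<Longrightarrow> y * s \<in> int_module.span S"
    using algebraic_int_common_module[OF assms] by blast
  show ?thesis
    by (rule algebraic_int_if_stabilizes_span[OF S(1,2)])
      (auto simp: distrib_right intro: int_module.span_add S)
qed

lemma algebraic_int_mult:
  assumes "algebraic_int x" "algebraic_int y"
  shows "algebraic_int (x * y)"
proof -
  obtain S where S: "finite S" "1 \<in> S"
    "\<And>s. s \<in> S \<Longrightarrow> x * s \<in> int_module.span S" "\<And>s. s \<in> S \<Longrightarrow> y * s \<in> int_module.span S"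
    using algebraic_int_common_module[OF assms] by blast
  show ?thesis
    by (rule algebraic_int_if_stabilizes_span[OF S(1,2)])
      (auto simp: mult.assoc intro: int_span_stable S)
qed

lemma algebraic_int_diff:
  "algebraic_int x \<Longrightarrow> algebraic_int y \<Longrightarrow> algebraic_int (x - y)"
  using algebraic_int_add[of x "-1 * y"] algebraic_int_mult[of "-1" y]
    algebraic_int_of_int_complex[of "-1"] by simp

lemma algebraic_int_power: "algebraic_int x \<Longrightarrow> algebraic_int (x ^ k)"
  by (induction k) (use algebraic_int_of_int_complex[of 1] in \<open>auto intro: algebraic_int_mult\<close>)

lemma algebraic_int_sum:
  "(\<And>i. i \<in> A \<Longrightarrow> algebraic_int (f i)) \<Longrightarrow> algebraic_int (sum f A)"
  by (induction A rule: infinite_finite_induct)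
    (use algebraic_int_of_int_complex[of 0] in \<open>auto intro: algebraic_int_add\<close>)

lemma algebraic_int_poly:
  "algebraic_int x \<Longrightarrow> algebraic_int (poly (map_poly of_int p) x)"
  by (auto simp: poly_altdef
      intro!: algebraic_int_sum algebraic_int_mult algebraic_int_power)

section \<open>Evaluation of integer and rational polynomials\<close>

interpretation of_rat_poly_hom: map_poly_idom_hom "of_rat :: rat \<Rightarrow> complex" ..

lemma poly_of_rat_eq_sum:
  assumes "degree p < N"
  shows "poly (map_poly of_rat p) (x::complex) = (\<Sum>i<N. of_rat (coeff p i) * x ^ i)"
proof -
  have "poly (map_poly of_rat p) x = (\<Sum>i\<le>degree p. of_rat (coeff p i) * x ^ i)"
    by (simp add: poly_altdef)
  also have "\<dots> = (\<Sum>i<N. of_rat (coeff p i) * x ^ i)"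
    by (rule sum.mono_neutral_left) (use assms in \<open>auto simp: coeff_eq_0\<close>)
  finally show ?thesis .
qed

lemma degree_monom_diff_const:
  "n > 0 \<Longrightarrow> degree (monom 1 n - [:c:] :: 'a :: comm_ring_1 poly) = n"
  using degree_add_eq_left[of "[:- c:]" "monom 1 n"]
  by (simp add: degree_monom_eq diff_conv_add_uminus del: add_uminus_conv_diff)

lemma map_poly_of_rat_of_int:
  "map_poly of_rat (map_poly of_int q) = (map_poly of_int q :: complex poly)"
  by (rule poly_eqI) (simp add: coeff_map_poly)

lemma of_int_coeffs_rat_poly:
  assumes "\<And>i. coeff p i \<in> (\<int> :: rat set)"
  obtains q :: "int poly" where "map_poly of_int q = p"
proof
  show "map_poly of_int (map_poly floor p) = p"
    by (rule poly_eqI) (use assms in \<open>auto simp: coeff_map_poly elim!: Ints_cases\<close>)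
qed

lemma rat_poly_clear_denominators:
  fixes p :: "rat poly"
  obtains d :: int and q :: "int poly" where "d > 0" "map_poly of_int q = Polynomial.smult (of_int d) p"
proof -
  have "\<exists>d::int. d > 0 \<and> (\<forall>i. of_int d * coeff p i \<in> \<int>)"
  proof (induction p)
    case 0
    then show ?case by (intro exI[of _ 1]) auto
  next
    case (pCons c p)
    then obtain d where d: "d > 0" "\<And>i. of_int d * coeff p i \<in> \<int>" by blast
    obtain m e where c: "c = of_int m / of_int e" "e > 0"
      by (metis quotient_of_div quotient_of_denom_pos surj_pair)
    have "of_int (e * d) * coeff (pCons c p) i \<in> \<int>" for i
    proof (cases i)
      case 0
      have "of_int (e * d) * c = of_int (d * m)"
        using c by (simp add: field_simps)
      then show ?thesis using 0 by (metis Ints_of_int coeff_pCons_0)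
    next
      case (Suc j)
      then show ?thesis using Ints_mult[OF Ints_of_int[of e] d(2)[of j]]
        by (simp add: mult.assoc)
    qed
    then show ?case using d(1) c(2) by (metis mult_pos_pos)
  qed
  then obtain d :: int where d: "d > 0" "\<And>i. of_int d * coeff p i \<in> \<int>" by blast
  then obtain q where "map_poly of_int q = Polynomial.smult (of_int d) p"
    using of_int_coeffs_rat_poly[of "Polynomial.smult (of_int d) p"] by (metis coeff_smult)
  with d show ?thesis using that by blast
qed

lemma Qadj_subset:
  assumes "y \<in> Qadj x"
  shows "Qadj y \<subseteq> Qadj x"
proof
  fix z assume "z \<in> Qadj y"
  then obtain p q where "z = poly (map_poly of_rat p) y" "y = poly (map_poly of_rat q) x"
    using assms unfolding Qadj_def by blast
  then have "z = poly (map_poly of_rat (pcompose p q)) x"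
    by (simp add: of_rat_hom.map_poly_pcompose poly_pcompose)
  then show "z \<in> Qadj x" unfolding Qadj_def by blast
qed

lemma Zadj_subset_Qadj: "Zadj x \<subseteq> Qadj x"
  unfolding Zadj_def Qadj_def by (auto simp flip: map_poly_of_rat_of_int)

section \<open>Roots of unity\<close>

lemma primitive_root_of_unity_exists:
  assumes "n > 0"
  obtains \<zeta> :: complex where "\<zeta> ^ n = 1" "\<And>m. \<zeta> ^ m = 1 \<longleftrightarrow> n dvd m"
proof
  define \<zeta> where "\<zeta> = cis (2 * pi / real n)"
  have pow: "\<zeta> ^ k = cis (2 * pi * real k / real n)" for k
    by (simp add: \<zeta>_def DeMoivre field_simps)
  show 1: "\<zeta> ^ n = 1" using assms by (simp add: pow)
  fix m
  have "\<zeta> ^ m = (\<zeta> ^ n) ^ (m div n) * \<zeta> ^ (m mod n)"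
    by (simp flip: power_mult power_add)
  then have m: "\<zeta> ^ m = \<zeta> ^ (m mod n)" by (simp add: 1)
  \<comment> \<open>Distinctness of the powers below \<open>n\<close> comes from their bijection
    with the \<open>n\<close>-th roots of unity.\<close>
  have "inj_on (\<lambda>k. \<zeta> ^ k) {..<n}"
    using bij_betw_roots_unity[OF assms] by (simp add: pow bij_betw_def)
  then have "\<zeta> ^ (m mod n) = \<zeta> ^ 0 \<longleftrightarrow> m mod n = 0"
    using assms by (subst inj_on_eq_iff) auto
  with m show "\<zeta> ^ m = 1 \<longleftrightarrow> n dvd m" by (simp add: dvd_eq_mod_eq_0)
qed

text \<open>Orthogonality: a geometric sum of length \<open>n\<close> vanishes if its ratio is not 1
  but has \<open>n\<close>-th power 1.\<close>

lemma sum_powers_root_of_unity: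
  fixes \<zeta> :: complex
  assumes "\<zeta> ^ n = 1" "\<And>m. \<zeta> ^ m = 1 \<longleftrightarrow> n dvd m"
  shows "(\<Sum>j<n. (\<zeta> ^ m) ^ j) = (if n dvd m then of_nat n else 0)"
proof (cases "n dvd m")
  case False
  have "(\<zeta> ^ m) ^ n = (\<zeta> ^ n) ^ m" by (simp flip: power_mult add: mult.commute)
  with False show ?thesis using assms by (simp add: sum_gp_strict)
next
  case True
  then have "\<zeta> ^ m = 1" using assms by blast
  with True show ?thesis by simp
qed

section \<open>Radicals of square-free integers\<close>

text \<open>The last two assumptions provide a prime dividing \<open>a\<close> exactly once, so that
  X ^ n - \<open>a\<close> is Eisenstein at it.\<close>

locale squarefree_radical =
  fixes n :: nat and a :: int and \<theta> :: complex
  assumes n_pos: "n > 0"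
    and root: "\<theta> ^ n = of_int a"
    and sqfree: "squarefree a"
    and not_unit: "\<not> is_unit a"
begin

lemma a_nonzero: "a \<noteq> 0"
  using sqfree by auto

lemma theta_integral: "algebraic_int \<theta>"
  using algebraic_int_nth_root[OF root n_pos] .

lemma power_theta_mod: "\<theta> ^ k = of_int a ^ (k div n) * \<theta> ^ (k mod n)"
proof -
  have "\<theta> ^ k = \<theta> ^ (n * (k div n) + k mod n)" by simp
  then show ?thesis by (simp only: power_add power_mult root)
qed

section \<open>The Eisenstein argument at a prime dividing \<open>a\<close>\<close>

lemma prime_dvd_if_top_power_integral:
  assumes p: "prime p" "p dvd a"
    and int: "algebraic_int (of_int b * \<theta> ^ (n - 1) / of_int p)"
  shows "p dvd b"
proof -
  obtain c where c: "a = p * c" using p by blast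
  have "\<not> p dvd c"
  proof
    assume "p dvd c"
    then have "p\<^sup>2 dvd a" unfolding c power2_eq_square by simp
    then have "is_unit p" using sqfree unfolding squarefree_def by blast
    with p show False using not_prime_unit by blast
  qed
  have p0: "p \<noteq> 0" using p by auto
  let ?z = "of_int b * \<theta> ^ (n - 1) / of_int p"
  have "?z ^ n = of_int b ^ n * (\<theta> ^ n) ^ (n - 1) / of_int p ^ n"
    by (simp add: power_mult_distrib power_divide mult.commute flip: power_mult)
  also have "\<dots> = of_int (b ^ n * a ^ (n - 1)) / of_int (p ^ n)"
    by (simp add: root)
  finally have z: "?z ^ n = of_int (b ^ n * a ^ (n - 1)) / of_int (p ^ n)" .
  have "?z ^ n \<in> \<int>"
    by (rule algebraic_int_rational_is_int[OF algebraic_int_power[OF int]]) (unfold z, intro Rats_divide Rats_of_int)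
  then obtain m where "?z ^ n = of_int m" by (elim Ints_cases)
  then have "complex_of_int (b ^ n * a ^ (n - 1)) / of_int (p ^ n) = of_int m"
    unfolding z .
  then have "complex_of_int (b ^ n * a ^ (n - 1)) = of_int (m * p ^ n)"
    using p0 by (simp add: field_simps)
  then have "b ^ n * a ^ (n - 1) = m * p ^ n" by (simp only: of_int_eq_iff)
  also have "p ^ n = p * p ^ (n - 1)" using n_pos by (cases n) auto
  \<comment> \<open>Cancelling \<open>p ^ (n - 1)\<close> leaves one factor \<open>p\<close> on the
    right, while \<open>c\<close> is prime to \<open>p\<close>.\<close>
  finally have "b ^ n * c ^ (n - 1) = m * p"
    using p0 by (simp add: c power_mult_distrib)
  then have "p dvd b ^ n * c ^ (n - 1)" by simp
  with \<open>\<not> p dvd c\<close> p show "p dvd b"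
    by (metis prime_dvd_mult_iff prime_dvd_power)
qed

lemma prime_dvd_coeffs:
  assumes p: "prime p" "p dvd a"
    and int: "algebraic_int (poly (map_poly of_int R) \<theta> / of_int p)"
    and "i < n"
  shows "p dvd coeff R i"
  using \<open>i < n\<close>
proof (induction i rule: less_induct)
  case (less i)
  show ?case
  proof (cases "i \<le> degree R")
    case False
    then show ?thesis by (simp add: coeff_eq_0)
  next
    case True
    \<comment> \<open>The extra exponent moves index \<open>i\<close> to \<open>n - 1\<close>, the
      largest power that does not yet produce a factor \<open>a\<close>.\<close>
    let ?f = "\<lambda>j. of_int (coeff R j) * \<theta> ^ (j + (n - 1 - i)) / of_int p"
    obtain c where c: "a = p * c" using p by blast
    have p0: "p \<noteq> 0" using p by auto
    \<comment> \<open>Below \<open>i\<close> the induction hypothesis supplies the factor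
      \<open>p\<close>; above \<open>i\<close> the exponent reaches \<open>n\<close>, and
      \<open>\<theta> ^ n = a\<close> supplies it.\<close>
    have others: "algebraic_int (?f j)" if "j \<noteq> i" for j
    proof (cases "j < i")
      case True
      then obtain d where d: "coeff R j = p * d" using less by force
      have "?f j = of_int d * \<theta> ^ (j + (n - 1 - i))" using p0 by (simp add: d)
      then show ?thesis
        using algebraic_int_mult[OF _ algebraic_int_power[OF theta_integral]] by simp
    next
      case False
      then have "j + (n - 1 - i) = n + (j - i - 1)" using that less.prems by simp
      then have "?f j = of_int (coeff R j * c) * \<theta> ^ (j - i - 1)"
        using p0 by (simp add: power_add root c)
      then show ?thesis
        using algebraic_int_mult[OF algebraic_int_of_int_complex algebraic_int_power[OF theta_integral]]
        by (simp only:)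
    qed
    have "poly (map_poly of_int R) \<theta> / of_int p * \<theta> ^ (n - 1 - i) = (\<Sum>j\<le>degree R. ?f j)"
      by (simp add: poly_altdef sum_distrib_right sum_divide_distrib power_add mult.assoc)
    also have "\<dots> = ?f i + (\<Sum>j\<in>{..degree R} - {i}. ?f j)"
      using True by (intro sum.remove) auto
    finally have "?f i = poly (map_poly of_int R) \<theta> / of_int p * \<theta> ^ (n - 1 - i)
        - (\<Sum>j\<in>{..degree R} - {i}. ?f j)" by simp
    also have "algebraic_int \<dots>"
      by (intro algebraic_int_diff algebraic_int_mult int algebraic_int_power theta_integral
          algebraic_int_sum others) auto
    finally have "algebraic_int (?f i)" .
    moreover have "i + (n - 1 - i) = n - 1" using less.prems by simp
    ultimately show ?thesis
      using prime_dvd_if_top_power_integral[OF p] by simp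
  qed
qed

section \<open>Degree of \<theta> and of its powers; irreducibility\<close>

lemma prime_divisor:
  obtains p where "prime p" "p dvd a"
  using prime_divisor_exists[OF a_nonzero not_unit] by blast

lemma int_poly_root_eq_0:
  assumes "degree q < n" "poly (map_poly of_int q) \<theta> = 0"
  shows "q = 0"
proof (rule ccontr)
  assume "q \<noteq> 0"
  obtain p where p: "prime p" "p dvd a" by (rule prime_divisor)
  \<comment> \<open>The value 0 stays integral after division by \<open>p\<close>, so
    \<open>p\<close> would divide every coefficient of \<open>r\<close>, contradicting content
    1.\<close>
  define r where "r = primitive_part q"
  have "poly (map_poly of_int (Polynomial.smult (content q) r)) \<theta> = 0"
    using assms by (simp add: r_def)
  then have "poly (map_poly of_int r) \<theta> = 0"
    using \<open>q \<noteq> 0\<close> by (simp add: hom_distribs)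
  then have "algebraic_int (poly (map_poly of_int r) \<theta> / of_int p)"
    using algebraic_int_of_int_complex[of 0] by simp
  then have "p dvd coeff r i" if "i < n" for i
    using prime_dvd_coeffs[OF p _ that] by blast
  moreover have "degree r < n" using assms by (simp add: r_def)
  ultimately have "p dvd coeff r i" for i
    by (cases "i < n") (auto simp: coeff_eq_0)
  then have "[:p:] dvd r" by (simp add: const_poly_dvd_iff)
  then have "p dvd content r" by (simp add: const_poly_dvd_iff_dvd_content)
  then have "is_unit p" using \<open>q \<noteq> 0\<close> by (simp add: r_def)
  then show False using p not_prime_unit by blast
qed

lemma rat_poly_root_eq_0:
  assumes "degree g < n" "poly (map_poly of_rat g) \<theta> = 0"
  shows "g = 0"
proof -
  obtain d q where d: "d > 0" and q: "map_poly of_int q = Polynomial.smult (of_int d) g"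
    by (rule rat_poly_clear_denominators)
  have "degree q = degree (map_poly of_int q :: rat poly)" by simp
  then have "degree q < n" using d assms by (simp add: q)
  moreover have "poly (map_poly of_int q) \<theta> = poly (map_poly of_rat (Polynomial.smult (of_int d) g)) \<theta>"
    by (simp flip: q add: map_poly_of_rat_of_int)
  then have "poly (map_poly of_int q) \<theta> = 0"
    using assms by (simp add: hom_distribs)
  ultimately have "q = 0" by (rule int_poly_root_eq_0)
  then show ?thesis using q d by simp
qed

text \<open>Since \<open>u\<close> is invertible modulo \<open>n\<close>, reducing the exponents
  \<open>u * i\<close> permutes the powers of \<theta> below \<open>n\<close> and scales them by
  nonzero powers of \<open>a\<close>; independence of those powers then applies.\<close>

lemma rat_poly_power_root_eq_0:
  assumes cop: "coprime u n" and deg: "degree g < n"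
    and g: "poly (map_poly of_rat g) (\<theta> ^ u) = 0"
  shows "g = 0"
proof -
  define e where "e i = u * i mod n" for i
  have inj: "inj_on e {..<n}"
  proof (rule inj_onI)
    fix i j assume ij: "i \<in> {..<n}" "j \<in> {..<n}" "e i = e j"
    then have "[u * i = u * j] (mod n)" by (simp add: e_def cong_def)
    then have "[i = j] (mod n)" using cop by (simp add: cong_mult_lcancel_nat)
    then show "i = j" using ij by (simp add: cong_def)
  qed
  define w where "w i = coeff g i * of_int a ^ (u * i div n)" for i
  define h where "h = (\<Sum>i<n. monom (w i) (e i))"
  have "poly (map_poly of_rat h) \<theta> = (\<Sum>i<n. of_rat (w i) * \<theta> ^ e i)"
    by (simp add: h_def hom_distribs poly_sum poly_monom)
  also have "\<dots> = (\<Sum>i<n. of_rat (coeff g i) * (\<theta> ^ u) ^ i)"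
    by (rule sum.cong)
      (simp_all add: w_def e_def of_rat_mult of_rat_power mult.assoc
        flip: power_theta_mod power_mult)
  also have "\<dots> = 0" using g by (simp add: poly_of_rat_eq_sum[OF deg])
  finally have "poly (map_poly of_rat h) \<theta> = 0" .
  moreover have "degree h < n"
    unfolding h_def
  proof (rule degree_sum_less)
    fix i assume "i \<in> {..<n}"
    have "degree (monom (w i) (e i)) \<le> e i" by (rule degree_monom_le)
    also have "e i < n" using n_pos by (simp add: e_def)
    finally show "degree (monom (w i) (e i)) < n" .
  qed (rule n_pos)
  ultimately have h0: "h = 0" using rat_poly_root_eq_0 by blast
  have "coeff g i = 0" if "i < n" for i
  proof -
    have "coeff h (e i) = (\<Sum>j<n. if j = i then w j else 0)"
      unfolding h_def coeff_sum
      by (rule sum.cong) (use inj that in \<open>auto simp: inj_on_eq_iff\<close>)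
    then have "w i = 0" using h0 that by simp
    then show ?thesis using a_nonzero by (simp add: w_def)
  qed
  then show "g = 0" using deg by (metis leading_coeff_0_iff)
qed

text \<open>A factor vanishing at \<open>\<theta> ^ u\<close> has degree at least \<open>n\<close>,
  so its cofactor is constant.\<close>

lemma irreducible_power:
  assumes "coprime u n"
  shows "irreducible (monom 1 n - [:of_int (a ^ u):] :: rat poly)" (is "irreducible ?F")
proof (rule irreducibleI)
  have degF: "degree ?F = n" using n_pos by (rule degree_monom_diff_const)
  then show F0: "?F \<noteq> 0" using n_pos by auto
  show "\<not> is_unit ?F" using degF n_pos by (simp add: is_unit_iff_degree F0)
  have "poly (map_poly of_rat ?F) (\<theta> ^ u) = (\<theta> ^ n) ^ u - of_int a ^ u"
    by (simp add: hom_distribs poly_monom of_rat_power mult.commute flip: power_mult)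
  then have zero: "poly (map_poly of_rat ?F) (\<theta> ^ u) = 0" by (simp add: root)
  have unit: "is_unit k" if "?F = g * k" "poly (map_poly of_rat g) (\<theta> ^ u) = 0" for g k
  proof -
    have nz: "g \<noteq> 0" "k \<noteq> 0" using F0 that by auto
    then have "\<not> degree g < n" using rat_poly_power_root_eq_0[OF assms _ that(2)] by blast
    moreover have "degree g + degree k = n" using degF nz unfolding that(1) by (simp add: degree_mult_eq)
    ultimately show ?thesis using nz by (simp add: is_unit_iff_degree)
  qed
  fix g h assume gh: "?F = g * h"
  have "poly (map_poly of_rat (g * h)) (\<theta> ^ u) = 0" using zero unfolding gh .
  then have "poly (map_poly of_rat g) (\<theta> ^ u) = 0 \<or> poly (map_poly of_rat h) (\<theta> ^ u) = 0"
    by (simp add: hom_distribs)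
  then show "is_unit g \<or> is_unit h"
    using unit[of g h] unit[of h g] gh by (auto simp: mult.commute)
qed

text \<open>\<open>prime_dvd_coeffs\<close> restricts the index but not the degree, so it applies to
  X - P(X ^ u) for \<open>P\<close> of any degree.\<close>

lemma theta_notin_Zadj_power:
  assumes "n \<ge> 2" "u \<ge> 2"
  shows "\<theta> \<notin> Zadj (\<theta> ^ u)"
proof
  assume "\<theta> \<in> Zadj (\<theta> ^ u)"
  then obtain P where P: "\<theta> = poly (map_poly of_int P) (\<theta> ^ u)"
    unfolding Zadj_def by blast
  define R where "R = monom 1 1 - pcompose P (monom 1 u)"
  have "poly (map_poly of_int R) \<theta> = 0"
    using P by (simp add: R_def hom_distribs of_int_hom.map_poly_pcompose poly_pcompose poly_monom)
  moreover obtain p where p: "prime p" "p dvd a" by (rule prime_divisor)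
  ultimately have "p dvd coeff R 1"
    using prime_dvd_coeffs[of p R 1] algebraic_int_of_int_complex[of 0] assms by simp
  \<comment> \<open>Only exponents divisible by \<open>u\<close> occur, and \<open>u\<close> is at
    least 2.\<close>
  moreover have "coeff (pcompose P (monom 1 u)) 1 = 0"
    using assms(2)
    by (induction P) (auto simp: pcompose_pCons coeff_monom_mult coeff_pCons split: nat.splits)
  ultimately have "is_unit p" by (simp add: R_def)
  then show False using p not_prime_unit by blast
qed

section \<open>Passage to the conjugates of \<theta>\<close>

lemma rat_poly_reduce:
  obtains Q where "degree Q < n"
    "\<And>z. z ^ n = of_int a \<Longrightarrow> poly (map_poly of_rat P) z = poly (map_poly of_rat Q) (z::complex)"
proof
  let ?F = "monom 1 n - [:of_int a:] :: rat poly"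
  have degF: "degree ?F = n" using n_pos by (rule degree_monom_diff_const)
  then have F0: "?F \<noteq> 0" using n_pos by auto
  show "degree (P mod ?F) < n"
    using degree_mod_less[OF F0, of P] degF n_pos by auto
  fix z :: complex assume z: "z ^ n = of_int a"
  have "poly (map_poly of_rat P) z = poly (map_poly of_rat (P div ?F * ?F + P mod ?F)) z"
    by (simp only: div_mult_mod_eq)
  also have "\<dots> = poly (map_poly of_rat (P mod ?F)) z"
    using z by (simp add: hom_distribs poly_monom del: div_mult_mod_eq)
  finally show "poly (map_poly of_rat P) z = poly (map_poly of_rat (P mod ?F)) z" .
qed

text \<open>Replaces field embeddings: one remainder \<open>Q\<close> serves all roots of X ^ n -
  \<open>a\<close> at once, and it is zero because it vanishes at \<theta>.\<close>

lemma rat_poly_vanishes_at_conjugate: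
  assumes "poly (map_poly of_rat P) \<theta> = 0" "z ^ n = of_int a"
  shows "poly (map_poly of_rat P) (z::complex) = 0"
proof -
  obtain Q where Q: "degree Q < n"
    "\<And>z. z ^ n = of_int a \<Longrightarrow> poly (map_poly of_rat P) z = poly (map_poly of_rat Q) (z::complex)"
    using rat_poly_reduce[of P] by blast
  then have "Q = 0" using rat_poly_root_eq_0 assms(1) root by metis
  then show ?thesis using Q(2)[OF assms(2)] by simp
qed

lemma conjugate_integral:
  assumes "algebraic_int (poly (map_poly of_rat P) \<theta>)" "z ^ n = of_int a"
  shows "algebraic_int (poly (map_poly of_rat P) z)"
proof -
  obtain q where q: "lead_coeff q = 1" "poly (map_poly of_int q) (poly (map_poly of_rat P) \<theta>) = 0"
    using assms(1) unfolding algebraic_int_def by blast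
  have eval: "poly (map_poly of_rat (pcompose (map_poly of_int q) P)) y
      = poly (map_poly of_int q) (poly (map_poly of_rat P) y)" for y :: complex
    by (simp add: of_rat_hom.map_poly_pcompose poly_pcompose map_poly_of_rat_of_int)
  have "poly (map_poly of_int q) (poly (map_poly of_rat P) z) = 0"
    using rat_poly_vanishes_at_conjugate[OF _ assms(2)] q(2) unfolding eval[symmetric] by blast
  with q(1) show ?thesis unfolding algebraic_int_def by blast
qed

text \<open>Weighting the conjugates of an integer by powers of a primitive root of unity and summing
  isolates a single term of its expansion in powers of \<open>\<theta>\<close>.\<close>
lemma n_times_a_times_coeff_is_int:
  assumes deg: "degree P < n" and int: "algebraic_int (poly (map_poly of_rat P) \<theta>)" and "i < n"
  shows "of_int (int n * a) * coeff P i \<in> \<int>"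
proof -
  obtain \<zeta> :: complex where \<zeta>: "\<zeta> ^ n = 1" "\<And>m. \<zeta> ^ m = 1 \<longleftrightarrow> n dvd m"
    using primitive_root_of_unity_exists[OF n_pos] by blast
  have \<zeta>_int: "algebraic_int \<zeta>" using algebraic_int_nth_root[of \<zeta> n 1] \<zeta> n_pos by simp
  let ?x = "\<lambda>j. poly (map_poly of_rat P) (\<theta> * \<zeta> ^ j)"
  \<comment> \<open>As \<open>\<zeta> ^ n = 1\<close>, the weight inverts the factor
    \<open>\<zeta> ^ (j * i)\<close> at index \<open>i\<close>; using \<open>n - i\<close> keeps the
    exponent natural.\<close>
  let ?s = "\<Sum>j<n. \<zeta> ^ (j * (n - i)) * ?x j"
  have conj: "(\<theta> * \<zeta> ^ j) ^ n = of_int a" for j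
    using \<zeta>(1) power_mult[of \<zeta> n j]
    by (simp add: power_mult_distrib root mult.commute flip: power_mult)
  have s_int: "algebraic_int ?s"
    by (intro algebraic_int_sum algebraic_int_mult algebraic_int_power \<zeta>_int
        conjugate_integral[OF int conj])
  \<comment> \<open>The number lies strictly between 0 and 2 n, so the only possible multiple is
    \<open>n\<close> itself.\<close>
  have dvd: "n dvd n - i + k \<longleftrightarrow> k = i" if "k < n" for k
  proof
    assume "n dvd n - i + k"
    then obtain c where c: "n - i + k = n * c" by blast
    have "0 < n * c" "n * c < n * 2" using c that \<open>i < n\<close> by linarith+
    then have "c = 1" by simp
    with c \<open>i < n\<close> show "k = i" by simp
  qed (use \<open>i < n\<close> in simp)
  have "?s = (\<Sum>j<n. \<Sum>k<n. of_rat (coeff P k) * \<theta> ^ k * (\<zeta> ^ (n - i + k)) ^ j)"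
    unfolding poly_of_rat_eq_sum[OF deg] sum_distrib_left
    by (intro sum.cong)
      (simp_all add: power_mult_distrib algebra_simps flip: power_mult power_add)
  also have "\<dots> = (\<Sum>k<n. of_rat (coeff P k) * \<theta> ^ k * (\<Sum>j<n. (\<zeta> ^ (n - i + k)) ^ j))"
    by (subst sum.swap) (simp add: sum_distrib_left)
  also have "\<dots> = (\<Sum>k<n. if k = i then of_rat (coeff P k) * \<theta> ^ k * of_nat n else 0)"
    by (intro sum.cong refl, subst sum_powers_root_of_unity[OF \<zeta>]) (auto simp: dvd)
  also have "\<dots> = of_rat (coeff P i) * \<theta> ^ i * of_nat n"
    using \<open>i < n\<close> by simp
  \<comment> \<open>Completing \<open>\<theta> ^ i\<close> to \<open>\<theta> ^ n = a\<close> makes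
    the integer rational; this is the origin of the factor \<open>a\<close> beside
    \<open>n\<close>.\<close>
  finally have "?s * \<theta> ^ (n - i) = of_rat (coeff P i) * of_nat n * (\<theta> ^ i * \<theta> ^ (n - i))"
    by simp
  also have "\<theta> ^ i * \<theta> ^ (n - i) = of_int a"
    using \<open>i < n\<close> by (simp flip: power_add add: root)
  finally have eq: "?s * \<theta> ^ (n - i) = of_rat (of_int (int n * a) * coeff P i)"
    by (simp add: of_rat_mult)
  have "complex_of_rat (of_int (int n * a) * coeff P i) \<in> \<int>"
    using algebraic_int_mult[OF s_int algebraic_int_power[OF theta_integral, of "n - i"]]
    unfolding eq by (rule algebraic_int_rational_is_int) simp
  then obtain m where "complex_of_rat (of_int (int n * a) * coeff P i) = of_int m"
    by (elim Ints_cases)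
  then have "complex_of_rat (of_int (int n * a) * coeff P i) = of_rat (of_int m)" by simp
  then have "of_int (int n * a) * coeff P i = of_int m" by (simp only: of_rat_eq_iff)
  then show ?thesis by simp
qed

section \<open>Removal of the denominators\<close>

lemma integral_quotient_in_Zadj:
  assumes "N \<noteq> 0" "\<And>p. prime p \<Longrightarrow> p dvd N \<Longrightarrow> p dvd a"
    and "degree R < n" "algebraic_int (poly (map_poly of_int R) \<theta> / of_int N)"
  shows "poly (map_poly of_int R) \<theta> / of_int N \<in> Zadj \<theta>"
  using assms
proof (induction N arbitrary: R rule: prime_divisors_induct)
  case zero
  then show ?case by simp
next
  case (unit N)
  then have "N = 1 \<or> N = -1" by (simp add: abs_if split: if_splits)
  then have "poly (map_poly of_int R) \<theta> / of_int N = poly (map_poly of_int (Polynomial.smult N R)) \<theta>"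
    by (auto simp: hom_distribs)
  then show ?case unfolding Zadj_def by blast
next
  case (factor p N)
  have p: "prime p" "p dvd a" and N: "N \<noteq> 0" using factor by auto
  have p0: "p \<noteq> 0" using p by auto
  \<comment> \<open>Multiplying by \<open>N\<close> leaves the denominator \<open>p\<close> alone,
    so the Eisenstein argument shows that \<open>p\<close> can be cancelled from
    \<open>R\<close>.\<close>
  have "algebraic_int (of_int N * (poly (map_poly of_int R) \<theta> / of_int (p * N)))"
    using factor.prems(4) by (intro algebraic_int_mult) auto
  then have "algebraic_int (poly (map_poly of_int R) \<theta> / of_int p)"
    using N by simp
  then have "p dvd coeff R i" for i
    using prime_dvd_coeffs[OF p] factor.prems(3) by (cases "i < n") (auto simp: coeff_eq_0)
  then have "[:p:] dvd R" by (simp add: const_poly_dvd_iff)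
  then obtain R' where R': "R = Polynomial.smult p R'" by (elim dvdE) simp
  then have *: "poly (map_poly of_int R) \<theta> / of_int (p * N) = poly (map_poly of_int R') \<theta> / of_int N"
    using p0 by (simp add: hom_distribs)
  show ?case
    unfolding * using factor.prems R' p0 N by (intro factor.IH) (auto simp flip: *)
qed

theorem ring_of_integers_eq_Zadj:
  assumes "\<And>p. prime p \<Longrightarrow> p dvd int n \<Longrightarrow> p dvd a"
  shows "ring_of_integers (Qadj \<theta>) = Zadj \<theta>"
proof (intro equalityI subsetI)
  fix x assume "x \<in> Zadj \<theta>"
  then show "x \<in> ring_of_integers (Qadj \<theta>)"
    using Zadj_subset_Qadj algebraic_int_poly[OF theta_integral]
    unfolding ring_of_integers_def Zadj_def by blast
next
  fix x assume x: "x \<in> ring_of_integers (Qadj \<theta>)"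
  then obtain P where P: "x = poly (map_poly of_rat P) \<theta>"
    unfolding ring_of_integers_def Qadj_def by blast
  obtain Q where Q: "degree Q < n" "x = poly (map_poly of_rat Q) \<theta>"
    using rat_poly_reduce[of P] root unfolding P by metis
  have int: "algebraic_int x" using x by (simp add: ring_of_integers_def)
  \<comment> \<open>A common denominator for the coefficients of \<open>Q\<close>; by assumption all
    its prime divisors divide \<open>a\<close>.\<close>
  define N where "N = int n * a"
  have N0: "N \<noteq> 0" using n_pos a_nonzero by (simp add: N_def)
  have "coeff (Polynomial.smult (of_int N) Q) i \<in> \<int>" for i
    using n_times_a_times_coeff_is_int[OF Q(1), of i] int Q
    by (cases "i < n") (auto simp: N_def coeff_eq_0)
  then obtain R where R: "map_poly of_int R = Polynomial.smult (of_int N) Q"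
    by (rule of_int_coeffs_rat_poly)
  have "degree R = degree (map_poly of_int R :: rat poly)" by simp
  then have deg: "degree R < n" using Q by (simp add: R N0)
  have "poly (map_poly of_int R) \<theta> = poly (map_poly of_rat (Polynomial.smult (of_int N) Q)) \<theta>"
    by (simp flip: R add: map_poly_of_rat_of_int)
  also have "\<dots> = of_int N * x" by (simp add: hom_distribs Q)
  finally have eq: "poly (map_poly of_int R) \<theta> / of_int N = x" using N0 by simp
  have "p dvd a" if "prime p" "p dvd N" for p
    using that assms by (auto simp: N_def prime_dvd_mult_iff)
  from integral_quotient_in_Zadj[OF N0 this deg] show "x \<in> Zadj \<theta>"
    unfolding eq using int by blast
qed

end

section \<open>Application to a given root of \<open>F\<close>\<close>

theorem theorem2p7:
  fixes n u :: nat and a :: int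
  assumes "n \<ge> 3" and "u \<ge> 2" and "coprime u n"
    and "squarefree a"
    and "\<forall>p::int. prime p \<longrightarrow> p dvd int n \<longrightarrow> p dvd a"
  defines "F \<equiv> (monom 1 n - [:a ^ u:] :: int poly)"
  shows "irreducible (map_poly of_int F :: rat poly)
    \<and> (\<forall>\<alpha> :: complex. poly (map_poly of_int F) \<alpha> = 0 \<longrightarrow>
         Zadj \<alpha> \<noteq> ring_of_integers (Qadj \<alpha>)
       \<and> (\<exists>\<theta> \<in> ring_of_integers (Qadj \<alpha>).
            Qadj \<theta> = Qadj \<alpha> \<and> Zadj \<theta> = ring_of_integers (Qadj \<alpha>)))"
proof (intro conjI allI impI)
  have "\<not> is_unit (int n)" using assms(1) by simp
  then obtain p where "prime p" "p dvd int n"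
    using prime_divisor_exists[of "int n"] assms(1) by auto
  then have not_unit: "\<not> is_unit a"
    using assms(5) not_prime_unit dvd_trans by blast
  have radical: "squarefree_radical n a \<theta>" if "\<theta> ^ n = of_int a" for \<theta>
    by unfold_locales (use that not_unit assms in auto)
  have a0: "a \<noteq> 0" using assms(4) by auto
  have "card {z :: complex. z ^ n = of_int a} \<noteq> 0"
    using card_nth_roots[of "of_int a" n] a0 assms(1) by simp
  \<comment> \<open>Irreducibility is claimed before any root of \<open>F\<close> is given, so an
    arbitrary \<open>n\<close>-th root of \<open>a\<close> is used for it.\<close>
  then obtain \<theta>\<^sub>0 :: complex where "\<theta>\<^sub>0 ^ n = of_int a"
    by (metis (mono_tags) card.empty empty_Collect_eq)
  then interpret r0: squarefree_radical n a \<theta>\<^sub>0 by (rule radical)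
  show "irreducible (map_poly of_int F :: rat poly)"
    using r0.irreducible_power[OF assms(3)] by (simp add: F_def hom_distribs)
  fix \<alpha> :: complex assume "poly (map_poly of_int F) \<alpha> = 0"
  then have \<alpha>: "\<alpha> ^ n = of_int a ^ u" by (simp add: F_def hom_distribs poly_monom)
  obtain s t where st: "u * s = n * t + 1"
    using bezout_nat[of u n] assms(2,3) by auto
  define \<theta> where "\<theta> = \<alpha> ^ s / of_int a ^ t"
  have pow: "\<alpha> ^ (n * k) = of_int a ^ (u * k)" for k
    by (simp add: power_mult \<alpha>)
  have "\<theta> ^ n = \<alpha> ^ (n * s) / of_int a ^ (n * t)"
    by (simp add: \<theta>_def power_divide mult.commute flip: power_mult)
  \<comment> \<open>The power of \<open>a\<close> that remains is \<open>u * s - n * t\<close>,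
    which is 1 by the choice of \<open>s\<close> and \<open>t\<close>.\<close>
  then have root: "\<theta> ^ n = of_int a" using a0 by (simp add: pow st)
  then interpret squarefree_radical n a \<theta> by (rule radical)
  have "\<theta> ^ u = \<alpha> ^ (u * s) / of_int a ^ (u * t)"
    by (simp add: \<theta>_def power_divide mult.commute flip: power_mult)
  then have \<theta>u: "\<theta> ^ u = \<alpha>" using a0 by (simp add: st pow)
  have "\<theta> = poly (map_poly of_rat (monom (1 / of_int a ^ t) s)) \<alpha>"
    by (simp add: \<theta>_def hom_distribs poly_monom of_rat_divide of_rat_power)
  then have \<theta>_in: "\<theta> \<in> Qadj \<alpha>" unfolding Qadj_def by blast
  have "\<alpha> = poly (map_poly of_rat (monom 1 u)) \<theta>"
    by (simp add: \<theta>u hom_distribs poly_monom)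
  then have \<alpha>_in: "\<alpha> \<in> Qadj \<theta>" unfolding Qadj_def by blast
  have Q: "Qadj \<theta> = Qadj \<alpha>"
    using Qadj_subset \<theta>_in \<alpha>_in by blast
  have \<theta>_int: "\<theta> \<in> ring_of_integers (Qadj \<alpha>)"
    using \<theta>_in theta_integral by (simp add: ring_of_integers_def)
  \<comment> \<open>The element \<theta> separates the two rings: it is integral but not an integer
    polynomial in \<open>\<alpha> = \<theta> ^ u\<close>.\<close>
  show "Zadj \<alpha> \<noteq> ring_of_integers (Qadj \<alpha>)"
    using theta_notin_Zadj_power[of u] \<theta>_int assms(1,2) by (auto simp: \<theta>u)
  have "Zadj \<theta> = ring_of_integers (Qadj \<alpha>)"
    using ring_of_integers_eq_Zadj assms(5) by (simp add: Q)
  with \<theta>_int Q show "\<exists>\<theta> \<in> ring_of_integers (Qadj \<alpha>).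
      Qadj \<theta> = Qadj \<alpha> \<and> Zadj \<theta> = ring_of_integers (Qadj \<alpha>)" by blast
qed

end
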